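(* For every bipartite graph $H$, the limit $$\lim_{n\to\infty} \frac{\tilde{r}(H,P_n)}{n}$$ exists and is finite.
   Context: $P_n$ denotes the path on $n$ vertices. For graphs $H_1,H_2$, the online Ramsey game is played on the edge set of the infinite complete graph $K_{\mathbb N}$ (vertex set $\mathbb N$), starting with no colored edges. In every round Builder selects a previously unselected edge and Painter colors it red or blue. The game ends as soon as, after a move of Painter, there is a red copy of $H_1$ or a blue copy of $H_2$. Builder tries to end the game as soon as possible, Painter tries to delay it. The online size Ramsey number $\tilde{r}(H_1,H_2)$ is the number of rounds of the game when both players play optimally. (In $\tilde r(H,P_n)$, $H$ is the red target graph and $P_n$ the blue target graph.) *)

theory Defs
  imports Complex_Main "HOL-Library.Extended_Real"
begin

type_synonym 'a graph = "'a set \<times> 'a set set"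

abbreviation verts :: "'a graph \<Rightarrow> 'a set" where
  "verts \<equiv> fst"

abbreviation edges :: "'a graph \<Rightarrow> 'a set set" where
  "edges \<equiv> snd"

definition finite_simple_graph :: "'a graph \<Rightarrow> bool" where
  "finite_simple_graph G \<longleftrightarrow>
     finite (verts G) \<and> (\<forall>e\<in>edges G. e \<subseteq> verts G \<and> card e = 2)"

definition bipartite :: "'a graph \<Rightarrow> bool" where
  "bipartite G \<longleftrightarrow>
     (\<exists>X Y. X \<union> Y = verts G \<and> X \<inter> Y = {} \<and>
        (\<forall>e\<in>edges G. \<exists>x\<in>X. \<exists>y\<in>Y. e = {x, y}))"

definition path_graph :: "nat \<Rightarrow> nat graph" where
  "path_graph n = ({..<n}, {{i, Suc i} | i. Suc i < n})"

definition board :: "nat set set" where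
  "board = {e. card e = 2}"

(* Copies need not be induced; isolated vertices of the target may go to any unused vertex. *)
definition has_copy :: "'a graph \<Rightarrow> nat set set \<Rightarrow> bool" where
  "has_copy H F \<longleftrightarrow>
     (\<exists>f. inj_on f (verts H) \<and> (\<forall>e\<in>edges H. f ` e \<in> F))"

datatype colour = Red | Blue

(* The rounds played so far, the most recent one first. *)
type_synonym history = "(nat set \<times> colour) list"

definition coloured :: "colour \<Rightarrow> history \<Rightarrow> nat set set" where
  "coloured c h = {e. (e, c) \<in> set h}"

type_synonym builder = "history \<Rightarrow> nat set"
type_synonym painter = "history \<Rightarrow> nat set \<Rightarrow> colour"

definition legal_builder :: "builder \<Rightarrow> bool" where
  "legal_builder \<beta> \<longleftrightarrow> (\<forall>h. \<beta> h \<in> board - fst ` set h)"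

primrec play :: "builder \<Rightarrow> painter \<Rightarrow> nat \<Rightarrow> history" where
  "play \<beta> \<pi> 0 = []"
| "play \<beta> \<pi> (Suc t) =
     (let h = play \<beta> \<pi> t; e = \<beta> h in (e, \<pi> h e) # h)"

definition game_over :: "'a graph \<Rightarrow> 'b graph \<Rightarrow> history \<Rightarrow> bool" where
  "game_over H1 H2 h \<longleftrightarrow>
     has_copy H1 (coloured Red h) \<or> has_copy H2 (coloured Blue h)"

(* The end of the game is only tested after a move of Painter, hence 1 \<le> t;
   a play that never ends has length Inf {} = \<infinity>. *)
definition num_rounds :: "'a graph \<Rightarrow> 'b graph \<Rightarrow> builder \<Rightarrow> painter \<Rightarrow> enat" where
  "num_rounds H1 H2 \<beta> \<pi> =
     Inf {enat t | t. 1 \<le> t \<and> game_over H1 H2 (play \<beta> \<pi> t)}"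

definition online_size_ramsey :: "'a graph \<Rightarrow> 'b graph \<Rightarrow> enat" where
  "online_size_ramsey H1 H2 =
     (INF \<beta>\<in>{\<beta>. legal_builder \<beta>}. SUP \<pi>. num_rounds H1 H2 \<beta> \<pi>)"

end

theory Submission
  imports Defs "HOL-Library.Ramsey"
begin

text \<open>
  Two blue paths on disjoint vertex sets can be merged at a cost independent of their lengths:
  Builder plays all edges between the last \<open>s\<close> vertices of the first path and the first \<open>s\<close>
  vertices of the second one. If all of them are red, they form a red \<open>K\<^sub>s\<^sub>,\<^sub>s\<close>, which contains the
  bipartite graph \<open>H\<close> when \<open>s\<close> is large; otherwise a blue edge joins the two paths, and fewer than
  \<open>2 * s\<close> vertices are lost. Thus \<open>n \<mapsto> r (n + 2 * s) + s\<^sup>2\<close> is subadditive, where \<open>r n\<close> is the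
  online Ramsey number of \<open>H\<close> versus the path on \<open>n\<close> vertices, and Fekete's lemma applies.
\<close>

section \<open>Fekete's lemma\<close>

lemma subadditive_mult_le:
  fixes g :: "nat \<Rightarrow> real"
  assumes "\<And>m n. g (m + n) \<le> g m + g n"
  shows "g (q * m + r) \<le> real q * g m + g r"
proof (induction q)
  case (Suc q)
  have "g (Suc q * m + r) = g (m + (q * m + r))" by (simp add: add.assoc)
  also have "\<dots> \<le> g m + g (q * m + r)" by (rule assms)
  finally show ?case using Suc by (simp add: algebra_simps)
qed simp

text \<open>Fekete: the limit is the infimum of the quotients, a real number because nonnegativity
  bounds them below.\<close>

lemma subadditive_nonneg_convergent:
  fixes g :: "nat \<Rightarrow> real"
  assumes sub: "\<And>m n. g (m + n) \<le> g m + g n" and nonneg: "\<And>n. 0 \<le> g n"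
  shows "\<exists>L. (\<lambda>n. g n / real n) \<longlonglongrightarrow> L"
proof -
  \<comment> \<open>Index 0 is left out: \<open>g 0 / 0\<close> is 0 by convention and would pull
    the infimum down to 0.\<close>
  define L where "L = (INF n\<in>{0<..}. g n / real n)"
  have bdd: "bdd_below ((\<lambda>n. g n / real n) ` {0<..})"
    by (rule bdd_belowI[of _ 0]) (auto simp: nonneg)
  have lower: "L \<le> g n / real n" if "n > 0" for n
    unfolding L_def by (rule cINF_lower[OF bdd]) (use that in auto)
  have "(\<lambda>n. g n / real n) \<longlonglongrightarrow> L"
  proof (rule order_tendstoI)
    fix a assume "a < L"
    then have "a < g n / real n" if "n > 0" for n
      using lower[OF that] by simp
    then show "\<forall>\<^sub>F n in sequentially. a < g n / real n"
      using eventually_gt_at_top[of "0::nat"] by (rule eventually_mono[rotated])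
  next
    fix a assume "L < a"
    then obtain m where m: "m > 0" "g m / real m < a"
      unfolding L_def using bdd by (subst (asm) cINF_less_iff) auto
    \<comment> \<open>A bound on \<open>g (n mod m)\<close> that does not depend on
      \<open>n\<close>, so its share \<open>M / n\<close> vanishes.\<close>
    define M where "M = (\<Sum>r<m. g r)"
    have upper: "g n / real n \<le> g m / real m + M / real n" if "n > 0" for n
    proof -
      have "g (n mod m) \<le> M"
        unfolding M_def by (rule member_le_sum) (use m nonneg in auto)
      moreover have "g n \<le> real (n div m) * g m + g (n mod m)"
        using subadditive_mult_le[of g "n div m" m "n mod m"] sub by simp
      moreover have "real (n div m) * g m \<le> real n / real m * g m"
        by (intro mult_right_mono of_nat_div_le_of_nat nonneg)
      ultimately have "g n \<le> real n / real m * g m + M" by linarith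
      then have "g n / real n \<le> (real n / real m * g m + M) / real n"
        by (rule divide_right_mono) simp
      also have "\<dots> = g m / real m + M / real n"
        using that m by (simp add: field_simps)
      finally show ?thesis .
    qed
    have "(\<lambda>n. g m / real m + M / real n) \<longlonglongrightarrow> g m / real m + 0"
      by (intro tendsto_intros lim_const_over_n)
    then have "\<forall>\<^sub>F n in sequentially. g m / real m + M / real n < a"
      by (rule order_tendstoD) (use m in simp)
    then show "\<forall>\<^sub>F n in sequentially. g n / real n < a"
      using eventually_gt_at_top[of "0::nat"]
      by eventually_elim (rule order.strict_trans1[OF upper])
  qed
  then show ?thesis by blast
qed

section \<open>Positions from which Builder can force a goal\<close>

text \<open>Backward induction with a budget of \<open>k\<close> further rounds: alternating
  quantifiers over moves replace strategies, so games compose by induction on \<open>k\<close>. The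
  disjunct \<open>Q h\<close> in the second equation lets Builder stop early.\<close>

primrec forces :: "(history \<Rightarrow> bool) \<Rightarrow> nat \<Rightarrow> history \<Rightarrow> bool" where
  "forces Q 0 h \<longleftrightarrow> Q h"
| "forces Q (Suc k) h \<longleftrightarrow>
     Q h \<or> (\<exists>e\<in>board - fst ` set h. \<forall>c. forces Q k ((e, c) # h))"

lemma forces_goal: "Q h \<Longrightarrow> forces Q k h"
  by (cases k) auto

lemma forces_Suc: "forces Q k h \<Longrightarrow> forces Q (Suc k) h"
proof (induction k arbitrary: h)
  case (Suc k)
  then show ?case using forces.simps(2)[of Q "Suc k" h] forces.simps(2)[of Q k h] by blast
qed simp

lemma forces_mono: "forces Q k h \<Longrightarrow> k \<le> k' \<Longrightarrow> forces Q k' h"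
  by (rule lift_Suc_mono_le[of "\<lambda>k. forces Q k h", unfolded le_bool_def, rule_format])
    (rule forces_Suc)

text \<open>Sequential composition: the second phase may depend on the position reached, which has
  the form \<open>g @ h\<close> because rounds are only prepended. Budget left over from the first
  phase is discarded by monotonicity.\<close>

lemma forces_trans:
  assumes "forces Q k h" and "\<And>g. Q (g @ h) \<Longrightarrow> forces Q' j (g @ h)"
  shows "forces Q' (k + j) h"
  using assms
proof (induction k arbitrary: h)
  case 0
  then show ?case using "0.prems"(2)[of "[]"] by simp
next
  case (Suc k)
  show ?case
  proof (cases "Q h")
    case True
    then show ?thesis using Suc.prems(2)[of "[]"] forces_mono[of Q' j h "Suc k + j"] by simp
  next
    case False
    then obtain e where e: "e \<in> board - fst ` set h" "\<And>c. forces Q k ((e, c) # h)"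
      using Suc.prems(1) by auto
    have "forces Q' (k + j) ((e, c) # h)" for c
      by (rule Suc.IH[OF e(2)]) (use Suc.prems(2)[of "_ @ [(e, c)]"] in simp)
    then show ?thesis using e(1) by auto
  qed
qed

lemma forces_weaken:
  assumes "forces Q k h" and "\<And>h. Q h \<Longrightarrow> Q' h"
  shows "forces Q' k h"
  using forces_trans[OF assms(1), of Q' 0] assms(2) by simp

text \<open>\<open>legal_builder\<close> demands a move at every history, including those where
  nothing is being forced; the infinite board always supplies one.\<close>

lemma ex_fresh_edge: "\<exists>e. e \<in> board - fst ` set h"
proof -
  have "inj (\<lambda>n::nat. {0, Suc n})" by (auto simp: inj_def doubleton_eq_iff)
  moreover have "range (\<lambda>n::nat. {0, Suc n}) \<subseteq> board" by (auto simp: board_def)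
  ultimately have "infinite board" using range_inj_infinite infinite_super by blast
  then show ?thesis using infinite_imp_nonempty[of "board - fst ` set h"] by auto
qed

section \<open>Forcing versus strategies\<close>

lemma forces_imp_strategy:
  assumes "forces Q k []"
  shows "\<exists>\<beta>. legal_builder \<beta> \<and> (\<forall>\<pi>. \<exists>t\<le>k. Q (play \<beta> \<pi> t))"
proof -
  \<comment> \<open>The two conditions say that \<open>Suc k\<close> is the least winning budget at
    \<open>h\<close>. By monotonicity it is unique, so the edge can be chosen from \<open>h\<close>
    alone, as a strategy requires.\<close>
  have "\<exists>e. e \<in> board - fst ` set h \<and>
          (\<forall>k. forces Q (Suc k) h \<and> \<not> forces Q k h \<longrightarrow> (\<forall>c. forces Q k ((e, c) # h)))" for h
  proof (cases "\<exists>k. forces Q (Suc k) h \<and> \<not> forces Q k h")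
    case True
    then obtain k where k: "forces Q (Suc k) h" "\<not> forces Q k h" by blast
    then obtain e where e: "e \<in> board - fst ` set h" "\<forall>c. forces Q k ((e, c) # h)"
      using forces_goal by auto
    have "k' = k" if "forces Q (Suc k') h" "\<not> forces Q k' h" for k'
      using that k forces_mono[of Q "Suc k" h k'] forces_mono[of Q "Suc k'" h k]
      by (meson le_antisym not_less_eq_eq)
    then show ?thesis using e by blast
  next
    case False
    then have none: "\<not> (forces Q (Suc k) h \<and> \<not> forces Q k h)" for k by blast
    obtain e where "e \<in> board - fst ` set h" using ex_fresh_edge by blast
    with none show ?thesis by (intro exI[of _ e]) (simp only: simp_thms)
  qed
  then obtain \<beta> where fresh: "\<And>h. \<beta> h \<in> board - fst ` set h"
    and good: "\<And>h k c. forces Q (Suc k) h \<Longrightarrow> \<not> forces Q k h \<Longrightarrow> forces Q k ((\<beta> h, c) # h)"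
    by metis
  \<comment> \<open>Either a smaller budget already wins here, or the chosen edge lowers the least
    budget by one.\<close>
  have "\<exists>t'\<le>t + k. Q (play \<beta> \<pi> t')" if "forces Q k (play \<beta> \<pi> t)" for \<pi> t k
    using that
  proof (induction k arbitrary: t)
    case (Suc k)
    show ?case
    proof (cases "forces Q k (play \<beta> \<pi> t)")
      case True
      then obtain t' where "t' \<le> t + k" "Q (play \<beta> \<pi> t')" using Suc.IH by blast
      then show ?thesis by (intro exI[of _ t']) simp
    next
      case False
      then have "forces Q k (play \<beta> \<pi> (Suc t))"
        using good[OF Suc.prems] by (simp add: Let_def)
      then obtain t' where "t' \<le> Suc t + k" "Q (play \<beta> \<pi> t')" using Suc.IH by blast
      then show ?thesis by (intro exI[of _ t']) simp
    qed
  qed auto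
  from this[where t = 0] have "\<exists>t\<le>k. Q (play \<beta> \<pi> t)" for \<pi>
    using assms by simp
  then show ?thesis using fresh unfolding legal_builder_def by blast
qed

lemma length_play [simp]: "length (play \<beta> \<pi> t) = t"
  by (induction t) (auto simp: Let_def)

lemma strategy_imp_forces:
  assumes "legal_builder \<beta>" and win: "\<And>\<pi>. \<exists>t\<le>k. Q (play \<beta> \<pi> t)"
  shows "forces Q k []"
proof (rule ccontr)
  assume lose: "\<not> forces Q k []"
  \<comment> \<open>Painter answers red unless that leaves Builder a forced win. At a position that
    is not winning some colour is safe, so this choice is safe too. The remaining budget is read off
    from the length of the history.\<close>
  define \<pi> :: painter where
    "\<pi> h e = (if forces Q (k - Suc (length h)) ((e, Red) # h) then Blue else Red)" for h e
  have "\<not> forces Q (k - t) (play \<beta> \<pi> t)" if "t \<le> k" for t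
    using that
  proof (induction t)
    case (Suc t)
    let ?h = "play \<beta> \<pi> t" and ?j = "k - Suc t"
    have "k - t = Suc ?j" using Suc.prems by simp
    then have "\<not> forces Q (Suc ?j) ?h" using Suc by simp
    moreover have "\<beta> ?h \<in> board - fst ` set ?h"
      using assms(1) unfolding legal_builder_def by blast
    ultimately obtain c where "\<not> forces Q ?j ((\<beta> ?h, c) # ?h)" by auto
    then have "\<not> forces Q ?j ((\<beta> ?h, \<pi> ?h (\<beta> ?h)) # ?h)"
      by (cases c) (auto simp: \<pi>_def)
    then show ?case by (simp add: Let_def)
  qed (use lose in simp)
  then show False using win[of \<pi>] forces_goal by blast
qed

section \<open>The game value in terms of forcing\<close>

lemma coloured_append: "coloured c (g @ h) = coloured c g \<union> coloured c h"
  by (auto simp: coloured_def)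

lemma has_copy_mono: "has_copy H F \<Longrightarrow> F \<subseteq> F' \<Longrightarrow> has_copy H F'"
  unfolding has_copy_def by blast

lemma game_over_append: "game_over H1 H2 h \<Longrightarrow> game_over H1 H2 (g @ h)"
  unfolding game_over_def coloured_append by (meson has_copy_mono Un_upper2)

lemma game_over_play_mono:
  assumes "game_over H1 H2 (play \<beta> \<pi> t)" and "t \<le> t'"
  shows "game_over H1 H2 (play \<beta> \<pi> t')"
  using assms(2,1)
proof (induction t' rule: dec_induct)
  case (step m)
  then show ?case using game_over_append[of H1 H2 "play \<beta> \<pi> m" "[_]"] by (simp add: Let_def)
qed

text \<open>Turns a weak bound into a strict one, since an infimum strictly below a bound has a
  witness in the set.\<close>

lemma less_enat_Suc_iff: "x < enat (Suc k) \<longleftrightarrow> x \<le> enat k"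
  by (cases x) auto

text \<open>A play that is over at time 0, as for an edgeless target, still counts one round; hence
  \<open>1 \<le> k\<close>. Since being over persists, any witness can be moved to time
  \<open>k\<close>.\<close>

lemma num_rounds_le_iff:
  "num_rounds H1 H2 \<beta> \<pi> \<le> enat k \<longleftrightarrow> 1 \<le> k \<and> (\<exists>t\<le>k. game_over H1 H2 (play \<beta> \<pi> t))"
proof -
  have "num_rounds H1 H2 \<beta> \<pi> \<le> enat k \<longleftrightarrow> (\<exists>t. 1 \<le> t \<and> t \<le> k \<and> game_over H1 H2 (play \<beta> \<pi> t))"
    unfolding num_rounds_def less_enat_Suc_iff[symmetric] Inf_less_iff by (auto simp: less_Suc_eq_le)
  also have "\<dots> \<longleftrightarrow> 1 \<le> k \<and> (\<exists>t\<le>k. game_over H1 H2 (play \<beta> \<pi> t))"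
    using game_over_play_mono[of H1 H2 \<beta> \<pi> _ k] by (meson order.trans order_refl)
  finally show ?thesis .
qed

lemma online_size_ramsey_le_iff:
  "online_size_ramsey H1 H2 \<le> enat k \<longleftrightarrow> 1 \<le> k \<and> forces (game_over H1 H2) k []"
proof -
  have "online_size_ramsey H1 H2 \<le> enat k \<longleftrightarrow>
      (\<exists>\<beta>. legal_builder \<beta> \<and> (\<forall>\<pi>. num_rounds H1 H2 \<beta> \<pi> \<le> enat k))"
    unfolding online_size_ramsey_def less_enat_Suc_iff[symmetric] INF_less_iff
    unfolding less_enat_Suc_iff SUP_le_iff by auto
  then show ?thesis
    unfolding num_rounds_le_iff using forces_imp_strategy strategy_imp_forces by metis
qed

text \<open>Edges already present cost nothing, so \<open>card E\<close> rounds suffice. Recording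
  \<open>h' = g @ h\<close> keeps the earlier colours available.\<close>

lemma forces_edges:
  assumes "finite E" and "E \<subseteq> board"
  shows "forces (\<lambda>h'. E \<subseteq> fst ` set h' \<and> (\<exists>g. h' = g @ h)) (card E) h"
  using assms
proof (induction E arbitrary: h rule: finite_induct)
  case (insert e E)
  show ?case
  proof (cases "e \<in> fst ` set h")
    case True
    have "forces (\<lambda>h'. insert e E \<subseteq> fst ` set h' \<and> (\<exists>g. h' = g @ h)) (card E) h"
      by (rule forces_weaken[OF insert.IH]) (use insert.prems True in auto)
    then show ?thesis
      by (rule forces_mono) (simp add: card_insert_le insert.hyps)
  next
    case False
    have "forces (\<lambda>h'. insert e E \<subseteq> fst ` set h' \<and> (\<exists>g. h' = g @ h)) (card E) ((e, c) # h)" for c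
      by (rule forces_weaken[OF insert.IH]) (use insert.prems in auto)
    then show ?thesis using False insert.prems insert.hyps by auto
  qed
qed (auto intro: exI[of _ "[]"])

section \<open>Playing a game on fresh vertices\<close>

definition relocate :: "nat \<Rightarrow> history \<Rightarrow> history" where
  "relocate N = map (\<lambda>(e, c). ((\<lambda>v. v + N) ` e, c))"

text \<open>The board looks the same after an injective renaming of vertices, and a shift by
  \<open>N\<close> avoids every edge of \<open>h\<close>. Histories are arbitrary lists, so only
  their entries in \<open>board\<close> are bounded; other entries can never clash with a legal
  move.\<close>

lemma forces_relocate:
  assumes "forces Q k g" and old: "\<And>e. e \<in> fst ` set h \<Longrightarrow> e \<in> board \<Longrightarrow> e \<subseteq> {..<N}"
  shows "forces (\<lambda>h'. \<exists>g. Q g \<and> h' = relocate N g @ h) k (relocate N g @ h)"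
  using assms(1)
proof (induction k arbitrary: g)
  case (Suc k)
  show ?case
  proof (cases "Q g")
    case False
    then obtain e where e: "e \<in> board" "e \<notin> fst ` set g" "\<And>c. forces Q k ((e, c) # g)"
      using Suc.prems by auto
    let ?e = "(\<lambda>v. v + N) ` e"
    have "?e \<in> board"
      using e(1) by (simp add: board_def card_image)
    moreover have "?e \<notin> fst ` set h"
    proof
      assume "?e \<in> fst ` set h"
      then have "?e \<subseteq> {..<N}" using old \<open>?e \<in> board\<close> by blast
      then have "e = {}" by auto
      then show False using e(1) by (simp add: board_def)
    qed
    moreover have "?e \<notin> fst ` set (relocate N g)"
    proof
      assume "?e \<in> fst ` set (relocate N g)"
      then obtain e' where "e' \<in> fst ` set g" "?e = (\<lambda>v. v + N) ` e'"
        unfolding relocate_def by force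
      then show False using e(2) inj_image_eq_iff[of "\<lambda>v. v + N" e e'] by simp
    qed
    moreover have "forces (\<lambda>h'. \<exists>g. Q g \<and> h' = relocate N g @ h) k ((?e, c) # relocate N g @ h)" for c
      using Suc.IH[OF e(3)[of c]] by (simp add: relocate_def)
    ultimately have "?e \<in> board - fst ` set (relocate N g @ h)"
      and "\<forall>c. forces (\<lambda>h'. \<exists>g. Q g \<and> h' = relocate N g @ h) k
        ((?e, c) # relocate N g @ h)"
      by (auto simp: image_Un)
    then show ?thesis unfolding forces.simps(2) by (intro disjI2 bexI[of _ ?e])
  qed auto
qed auto

lemma coloured_relocate: "coloured c (relocate N g) = (`) (\<lambda>v. v + N) ` coloured c g"
  by (force simp: coloured_def relocate_def)

lemma has_copy_relocate:
  assumes "has_copy H (coloured c g)"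
  shows "has_copy H (coloured c (relocate N g))"
proof -
  obtain f where "inj_on f (verts H)" "\<forall>e\<in>edges H. f ` e \<in> coloured c g"
    using assms unfolding has_copy_def by blast
  then show ?thesis
    unfolding has_copy_def coloured_relocate
    by (intro exI[of _ "\<lambda>v. f v + N"]) (auto simp: inj_on_def image_image[symmetric, of "\<lambda>v. v + N" f])
qed

lemma ex_vertex_bound:
  "\<exists>N. \<forall>e \<in> fst ` set (h :: history). e \<in> board \<longrightarrow> e \<subseteq> {..<N}"
proof -
  have "finite (\<Union> (fst ` set h \<inter> board))"
    by (auto simp: board_def intro!: finite_Union intro: card_ge_0_finite)
  then obtain N where "\<Union> (fst ` set h \<inter> board) \<subseteq> {..<N}"
    using finite_nat_iff_bounded by blast
  then show ?thesis by blast
qed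

section \<open>Paths as lists\<close>

text \<open>With vertex sequences, cutting and joining paths becomes splitting and appending
  lists.\<close>

definition path_list :: "nat set set \<Rightarrow> nat list \<Rightarrow> bool" where
  "path_list F xs \<longleftrightarrow> distinct xs \<and> successively (\<lambda>x y. {x, y} \<in> F) xs"

lemma has_copy_path_iff: "has_copy (path_graph n) F \<longleftrightarrow> (\<exists>xs. path_list F xs \<and> length xs = n)"
proof
  assume "has_copy (path_graph n) F"
  then obtain f where f: "inj_on f {..<n}"
    and edge: "\<forall>e\<in>{{i, Suc i} | i. Suc i < n}. f ` e \<in> F"
    unfolding has_copy_def path_graph_def fst_conv snd_conv by blast
  have "{f i, f (Suc i)} \<in> F" if "Suc i < n" for i
    using edge[rule_format, of "{i, Suc i}"] that by auto
  then have "path_list F (map f [0..<n])"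
    using f unfolding path_list_def by (auto simp: distinct_map successively_conv_nth atLeast0LessThan)
  then show "\<exists>xs. path_list F xs \<and> length xs = n" by (intro exI[of _ "map f [0..<n]"]) simp
next
  assume "\<exists>xs. path_list F xs \<and> length xs = n"
  then obtain xs where xs: "path_list F xs" "length xs = n" by blast
  then have "inj_on ((!) xs) {..<n}"
    unfolding path_list_def by (auto simp: inj_on_def nth_eq_iff_index_eq)
  moreover have "{xs ! i, xs ! Suc i} \<in> F" if "Suc i < n" for i
    using xs that unfolding path_list_def by (auto simp: successively_conv_nth)
  ultimately show "has_copy (path_graph n) F"
    unfolding has_copy_def path_graph_def by (intro exI[of _ "(!) xs"]) auto
qed

lemma path_list_appendD:
  assumes "path_list F (xs @ ys)"
  shows "path_list F xs" "path_list F ys"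
  using assms by (auto simp: path_list_def successively_append_iff)

lemma has_copy_path_le:
  assumes "path_list F xs" and "n \<le> length xs"
  shows "has_copy (path_graph n) F"
  unfolding has_copy_path_iff
proof (intro exI conjI)
  show "path_list F (take n xs)"
    using assms(1) path_list_appendD[of F "take n xs" "drop n xs"] by simp
qed (use assms(2) in simp)

text \<open>Locates a path inside the region where its game was played. Length 2 is needed because a
  one-vertex path may sit anywhere.\<close>

lemma path_list_vertex_in_edge:
  assumes "path_list F xs" and "2 \<le> length xs" and "v \<in> set xs"
  shows "\<exists>e\<in>F. e \<in> board \<and> v \<in> e"
proof -
  obtain i where i: "i < length xs" "xs ! i = v" using assms(3) by (auto simp: in_set_conv_nth)
  \<comment> \<open>The last vertex has no outgoing edge, so the edge before it is taken.\<close>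
  define j where "j = (if Suc i < length xs then i else i - 1)"
  have j: "Suc j < length xs" "i = j \<or> i = Suc j"
    using i assms(2) by (auto simp: j_def)
  then have "{xs ! j, xs ! Suc j} \<in> F"
    using assms(1) by (auto simp: path_list_def successively_conv_nth)
  moreover have "xs ! j \<noteq> xs ! Suc j"
    using assms(1) j by (simp add: path_list_def nth_eq_iff_index_eq)
  ultimately show ?thesis
    using j i by (intro bexI[of _ "{xs ! j, xs ! Suc j}"]) (auto simp: board_def)
qed

text \<open>Cut the first path after \<open>u\<close> and the second before \<open>v\<close>: only
  vertices of \<open>us\<close> and \<open>vs\<close> are lost, so \<open>xs\<close> and
  \<open>ys\<close> survive whole.\<close>

lemma path_list_join:
  assumes xs: "path_list F (xs @ us)" and ys: "path_list F (vs @ ys)"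
    and disj: "set (xs @ us) \<inter> set (vs @ ys) = {}"
    and uv: "u \<in> set us" "v \<in> set vs" "{u, v} \<in> F"
  shows "\<exists>zs. path_list F zs \<and> length xs + length ys \<le> length zs"
proof -
  obtain us1 us2 where us: "us = us1 @ u # us2" using uv(1) split_list by fast
  obtain vs1 vs2 where vs: "vs = vs1 @ v # vs2" using uv(2) split_list by fast
  have 1: "path_list F ((xs @ us1) @ [u])"
    using path_list_appendD(1)[of F "(xs @ us1) @ [u]" us2] xs us by simp
  have 2: "path_list F (v # vs2 @ ys)"
    using path_list_appendD(2)[of F vs1 "v # vs2 @ ys"] ys vs by simp
  have "path_list F (((xs @ us1) @ [u]) @ (v # vs2 @ ys))"
    unfolding path_list_def distinct_append successively_append_iff[of _ "(xs @ us1) @ [u]"]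
    using 1 2 uv(3) disj us vs unfolding path_list_def by auto
  then show ?thesis by (intro exI conjI) auto
qed

section \<open>Copies of the red target graph\<close>

text \<open>Each class of \<open>H\<close> has at most \<open>card (verts H)\<close> vertices, so
  the classes embed separately into \<open>U\<close> and \<open>V\<close>, whatever their
  sizes.\<close>

lemma has_copy_bipartite:
  fixes H :: "'a graph"
  assumes "finite_simple_graph H" and "bipartite H"
    and "finite U" "finite V" "U \<inter> V = {}"
    and "card (verts H) \<le> card U" "card (verts H) \<le> card V"
    and F: "\<And>u v. u \<in> U \<Longrightarrow> v \<in> V \<Longrightarrow> {u, v} \<in> F"
  shows "has_copy H F"
proof -
  obtain A B where AB: "A \<union> B = verts H" "A \<inter> B = {}"
    "\<forall>e\<in>edges H. \<exists>x\<in>A. \<exists>y\<in>B. e = {x, y}"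
    using assms(2) unfolding bipartite_def by (elim exE conjE)
  have fin: "finite (verts H)" using assms(1) by (simp add: finite_simple_graph_def)
  have "A \<subseteq> verts H" "B \<subseteq> verts H" using AB(1) by blast+
  then have "card A \<le> card U" "card B \<le> card V"
    using assms(6,7) card_mono[OF fin] by (meson order_trans)+
  moreover have "finite A" "finite B" using fin AB(1) by (auto intro: finite_subset)
  ultimately obtain f g where "f ` A \<subseteq> U" "inj_on f A" "g ` B \<subseteq> V" "inj_on g B"
    using card_le_inj assms(3,4) by metis
  then have f: "\<And>a. a \<in> A \<Longrightarrow> f a \<in> U" "inj_on f A"
    and g: "\<And>b. b \<in> B \<Longrightarrow> g b \<in> V" "inj_on g B"
    by auto
  define h where "h v = (if v \<in> A then f v else g v)" for v
  have hA: "h a = f a" if "a \<in> A" for a using that by (simp add: h_def)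
  have hB: "h b = g b" if "b \<in> B" for b using that AB(2) by (auto simp: h_def)
  have "inj_on h A" using f(2) by (simp add: hA cong: inj_on_cong)
  moreover have "inj_on h B" using g(2) by (simp add: hB cong: inj_on_cong)
  moreover have "h ` A \<subseteq> U" "h ` B \<subseteq> V" using f(1) g(1) by (auto simp: hA hB)
  ultimately have "inj_on h (verts H)"
    using \<open>U \<inter> V = {}\<close> AB(1) by (subst AB(1)[symmetric], subst inj_on_Un) blast
  moreover have "h ` e \<in> F" if e: "e \<in> edges H" for e
  proof -
    obtain x y where "x \<in> A" "y \<in> B" "e = {x, y}" using AB(3) e by blast
    then show ?thesis using F[OF f(1) g(1)] by (simp add: hA hB)
  qed
  ultimately show ?thesis unfolding has_copy_def by blast
qed

lemma has_copy_clique: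
  assumes "finite_simple_graph H" and "finite R" "card (verts H) \<le> card R"
    and F: "\<And>u v. u \<in> R \<Longrightarrow> v \<in> R \<Longrightarrow> u \<noteq> v \<Longrightarrow> {u, v} \<in> F"
  shows "has_copy H F"
proof -
  have "finite (verts H)" using assms(1) by (simp add: finite_simple_graph_def)
  then obtain f where f: "f ` verts H \<subseteq> R" "inj_on f (verts H)"
    using card_le_inj assms(2,3) by metis
  have "f ` e \<in> F" if "e \<in> edges H" for e
  proof -
    have "e \<subseteq> verts H" "card e = 2" using assms(1) that by (auto simp: finite_simple_graph_def)
    then obtain a b where "e = {a, b}" "a \<noteq> b" "a \<in> verts H" "b \<in> verts H"
      by (auto simp: card_2_iff)
    then show ?thesis using f F[of "f a" "f b"] by (auto simp: inj_on_def)
  qed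
  then show ?thesis using f(2) unfolding has_copy_def by blast
qed

lemma finite_simple_path_graph: "finite_simple_graph (path_graph n)"
  by (auto simp: finite_simple_graph_def path_graph_def)

text \<open>Makes the game value finite: Builder plays a whole clique of Ramsey-number size, and any
  colouring of it contains a target.\<close>

lemma ex_forces_game_over:
  assumes H1: "finite_simple_graph H1" and H2: "finite_simple_graph H2"
  shows "\<exists>k. forces (game_over H1 H2) k []"
proof -
  obtain r where r: "\<And>E. \<exists>R\<subseteq>{..<r}. card R = card (verts H1) \<and> clique R E \<or>
      card R = card (verts H2) \<and> indep R (E :: nat set set)"
    using ramsey2[where 'a = nat and m = "card (verts H1)" and n = "card (verts H2)"]
    by (metis card_lessThan finite_lessThan order_refl)
  define E where "E = {e \<in> Pow {..<r}. card e = 2}"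
  have "game_over H1 H2 h" if h: "E \<subseteq> fst ` set h" for h
  proof -
    obtain R where R: "R \<subseteq> {..<r}" and hom: "card R = card (verts H1) \<and> clique R (coloured Red h) \<or>
        card R = card (verts H2) \<and> indep R (coloured Red h)"
      using r by blast
    have "finite R" using R finite_subset by blast
    \<comment> \<open>Every pair has been played, so a set independent in red is a blue
      clique.\<close>
    have col: "{u, v} \<in> coloured Red h \<or> {u, v} \<in> coloured Blue h"
      if "u \<in> R" "v \<in> R" "u \<noteq> v" for u v
    proof -
      have "{u, v} \<in> E" using that R by (auto simp: E_def)
      then obtain c where "({u, v}, c) \<in> set h" using h by force
      then show ?thesis by (cases c) (auto simp: coloured_def)
    qed
    from hom show ?thesis
    proof
      assume "card R = card (verts H1) \<and> clique R (coloured Red h)"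
      then have "has_copy H1 (coloured Red h)"
        using has_copy_clique[OF H1 \<open>finite R\<close>] by (simp add: clique_def)
      then show ?thesis by (simp add: game_over_def)
    next
      assume "card R = card (verts H2) \<and> indep R (coloured Red h)"
      then have "has_copy H2 (coloured Blue h)"
        using has_copy_clique[OF H2 \<open>finite R\<close>] col by (simp add: indep_def)
      then show ?thesis by (simp add: game_over_def)
    qed
  qed
  moreover have "forces (\<lambda>h. E \<subseteq> fst ` set h \<and> (\<exists>g. h = g @ [])) (card E) []"
    by (rule forces_edges) (auto simp: E_def board_def)
  ultimately have "forces (game_over H1 H2) (card E) []"
    using forces_weaken by (metis (mono_tags, lifting))
  then show ?thesis by blast
qed

section \<open>Joining two games\<close>

text \<open>Joining costs each path at most \<open>s\<close> vertices at one end, leaving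
  \<open>(n + s) + (m + s) = n + m + 2 * s\<close>. The surplus \<open>2 * s\<close> is thus
  reproduced, as subadditivity requires.\<close>

lemma forces_join:
  fixes H :: "'a graph"
  assumes H: "finite_simple_graph H" "bipartite H"
    and s: "card (verts H) \<le> s" "1 \<le> s"
    and 1: "forces (game_over H (path_graph (n + 2 * s))) k []"
    and 2: "forces (game_over H (path_graph (m + 2 * s))) j []"
  shows "forces (game_over H (path_graph (n + m + 2 * s))) (k + j + s\<^sup>2) []"
proof -
  let ?G = "game_over H (path_graph (n + m + 2 * s))"
  have red: "?G h" if "has_copy H (coloured Red h)" for h
    using that by (simp add: game_over_def)
  have join: "forces ?G (s\<^sup>2) (h1 @ h0)"
    if over: "game_over H (path_graph (n + 2 * s)) h0" "game_over H (path_graph (m + 2 * s)) g"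
      and h1: "h1 = relocate N g"
      and N: "\<forall>e\<in>fst ` set h0. e \<in> board \<longrightarrow> e \<subseteq> {..<N}"
    for h0 h1 g N
  proof (cases "has_copy H (coloured Red h0) \<or> has_copy H (coloured Red h1)")
    case True
    then have "has_copy H (coloured Red (h1 @ h0))"
      unfolding coloured_append by (meson has_copy_mono Un_upper1 Un_upper2)
    then show ?thesis by (intro forces_goal red)
  next
    case False
    then have "has_copy (path_graph (n + 2 * s)) (coloured Blue h0)"
      "has_copy (path_graph (m + 2 * s)) (coloured Blue h1)"
      using over h1 has_copy_relocate[of H Red g N]
        has_copy_relocate[of "path_graph (m + 2 * s)" Blue g N]
      by (auto simp: game_over_def)
    then obtain xs ys where xs: "path_list (coloured Blue h0) xs" "length xs = n + 2 * s"
      and ys: "path_list (coloured Blue h1) ys" "length ys = m + 2 * s"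
      unfolding has_copy_path_iff by blast
    \<comment> \<open>Disjointness: the first path lies below \<open>N\<close> and the second from
      \<open>N\<close> on. Both have at least 2 vertices because \<open>1 \<le> s\<close>.\<close>
    have "x < N" if x: "x \<in> set xs" for x
    proof -
      obtain e where "e \<in> coloured Blue h0" "e \<in> board" "x \<in> e"
        using path_list_vertex_in_edge[OF xs(1) _ x] xs(2) s(2) by auto
      then show ?thesis using N by (force simp: coloured_def)
    qed
    moreover have "N \<le> y" if y: "y \<in> set ys" for y
    proof -
      obtain e where "e \<in> coloured Blue h1" "y \<in> e"
        using path_list_vertex_in_edge[OF ys(1) _ y] ys(2) s(2) by auto
      then show ?thesis by (auto simp: h1 coloured_relocate)
    qed
    ultimately have disj: "set xs \<inter> set ys = {}" by fastforce
    define us vs where "us = drop (n + s) xs" and "vs = take s ys"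
    have sub: "set us \<subseteq> set xs" "set vs \<subseteq> set ys"
      by (auto simp: us_def vs_def dest: in_set_dropD in_set_takeD)
    have card: "card (set us) = s" "card (set vs) = s"
      using xs ys by (auto simp: us_def vs_def path_list_def distinct_card)
    define E where "E = (\<lambda>(u, v). {u, v}) ` (set us \<times> set vs)"
    have "card E \<le> s\<^sup>2"
      using card_image_le[of "set us \<times> set vs" "\<lambda>(u, v). {u, v}"] card
      by (simp add: E_def card_cartesian_product power2_eq_square)
    moreover have "u \<noteq> v" if "u \<in> set us" "v \<in> set vs" for u v
      using disj sub that by blast
    then have "E \<subseteq> board" by (auto simp: E_def board_def)
    then have "forces (\<lambda>h. E \<subseteq> fst ` set h \<and> (\<exists>g. h = g @ h1 @ h0)) (card E) (h1 @ h0)"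
      by (intro forces_edges) (auto simp: E_def)
    then have "forces ?G (card E) (h1 @ h0)"
    proof (rule forces_weaken, elim conjE exE)
      fix h h2 assume E: "E \<subseteq> fst ` set h" and h: "h = h2 @ h1 @ h0"
      show "?G h"
      proof (cases "\<exists>u\<in>set us. \<exists>v\<in>set vs. {u, v} \<in> coloured Blue h")
        case True
        then obtain u v where uv: "u \<in> set us" "v \<in> set vs" "{u, v} \<in> coloured Blue h" by blast
        have "path_list (coloured Blue h) xs" "path_list (coloured Blue h) ys"
          using xs(1) ys(1) unfolding path_list_def h coloured_append
          by (auto elim: successively_mono)
        then have "\<exists>zs. path_list (coloured Blue h) zs \<and>
            length (take (n + s) xs) + length (drop s ys) \<le> length zs"
          using disj uv by (intro path_list_join[of _ _ us vs _ u v]) (auto simp: us_def vs_def)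
        then obtain zs where "path_list (coloured Blue h) zs" "n + m + 2 * s \<le> length zs"
          using xs(2) ys(2) by auto
        then show ?thesis unfolding game_over_def using has_copy_path_le by blast
      next
        \<comment> \<open>All played edges between \<open>us\<close> and \<open>vs\<close> are now
          red, a complete bipartite graph with classes of size \<open>s\<close>.\<close>
        case False
        have "{u, v} \<in> coloured Red h" if "u \<in> set us" "v \<in> set vs" for u v
        proof -
          have "{u, v} \<in> E" using that by (auto simp: E_def)
          then obtain c where "({u, v}, c) \<in> set h" using E by force
          then show ?thesis using False that by (cases c) (auto simp: coloured_def)
        qed
        then show ?thesis
          using disj sub card s(1) by (intro red has_copy_bipartite[OF H, of "set us" "set vs"]) auto
      qed
    qed
    ultimately show ?thesis by (rule forces_mono[rotated])
  qed
  \<comment> \<open>The shift \<open>N\<close> is chosen only once the history \<open>h0\<close> of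
    the first game is known.\<close>
  have "forces ?G (j + s\<^sup>2) h0" if over: "game_over H (path_graph (n + 2 * s)) h0" for h0
  proof -
    obtain N where N: "\<forall>e\<in>fst ` set h0. e \<in> board \<longrightarrow> e \<subseteq> {..<N}"
      using ex_vertex_bound by blast
    have "forces (\<lambda>h. \<exists>g. game_over H (path_graph (m + 2 * s)) g \<and> h = relocate N g @ h0) j
        (relocate N [] @ h0)"
      by (rule forces_relocate[OF 2]) (use N in blast)
    then have "forces (\<lambda>h. \<exists>g. game_over H (path_graph (m + 2 * s)) g \<and> h = relocate N g @ h0) j h0"
      by (simp add: relocate_def)
    then show ?thesis
      by (rule forces_trans) (use join[OF over _ refl N] in auto)
  qed
  then show ?thesis
    unfolding add.assoc[of k] by (intro forces_trans[OF 1]) simp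
qed

section \<open>Existence of the limit\<close>

theorem theorem1:
  fixes H :: "'a graph"
  assumes "finite_simple_graph H" and "bipartite H"
  shows "\<exists>L::real.
    (\<lambda>n. ereal_of_enat (online_size_ramsey H (path_graph n)) / ereal (real n))
      \<longlonglongrightarrow> ereal L"
proof -
  define r where "r n = the_enat (online_size_ramsey H (path_graph n))" for n
  have r: "online_size_ramsey H (path_graph n) = enat (r n)" for n
  proof -
    obtain k where "forces (game_over H (path_graph n)) k []"
      using ex_forces_game_over[OF assms(1) finite_simple_path_graph] by blast
    \<comment> \<open>\<open>Suc k\<close> rather than \<open>k\<close>, because the forced budget
      may be 0 while the game lasts at least one round.\<close>
    then have "online_size_ramsey H (path_graph n) \<le> enat (Suc k)"
      unfolding online_size_ramsey_le_iff by (simp add: forces_Suc del: forces.simps)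
    then show ?thesis unfolding r_def by (cases "online_size_ramsey H (path_graph n)") auto
  qed
  then have forces_r: "1 \<le> r n" "forces (game_over H (path_graph n)) (r n) []" for n
    using online_size_ramsey_le_iff[of H "path_graph n" "r n"] by auto
  \<comment> \<open>The successor ensures \<open>1 \<le> s\<close> even when \<open>H\<close> has no
    vertices.\<close>
  define s where "s = Suc (card (verts H))"
  \<comment> \<open>The shift by \<open>2 * s\<close> absorbs the lost vertices and the summand
    \<open>s\<^sup>2\<close> the joining cost, which makes \<open>g\<close> exactly
    subadditive.\<close>
  define g where "g n = real (r (n + 2 * s) + s\<^sup>2)" for n
  have "g (m + n) \<le> g m + g n" for m n
  proof -
    have "forces (game_over H (path_graph (m + n + 2 * s)))
        (r (m + 2 * s) + r (n + 2 * s) + s\<^sup>2) []"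
      by (rule forces_join[OF assms]) (use forces_r in \<open>auto simp: s_def\<close>)
    then have "online_size_ramsey H (path_graph (m + n + 2 * s))
        \<le> enat (r (m + 2 * s) + r (n + 2 * s) + s\<^sup>2)"
      unfolding online_size_ramsey_le_iff using forces_r(1)[of "m + 2 * s"] by simp
    then have "r (m + n + 2 * s) \<le> r (m + 2 * s) + r (n + 2 * s) + s\<^sup>2"
      by (simp add: r)
    then have "r (m + n + 2 * s) + s\<^sup>2 \<le> (r (m + 2 * s) + s\<^sup>2) + (r (n + 2 * s) + s\<^sup>2)"
      by linarith
    then show ?thesis unfolding g_def of_nat_add[symmetric] of_nat_le_iff .
  qed
  then obtain L where L: "(\<lambda>n. g n / real n) \<longlonglongrightarrow> L"
    using subadditive_nonneg_convergent[of g] by (auto simp: g_def)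
  have vanish: "(\<lambda>n. c / real (n + 2 * s)) \<longlonglongrightarrow> 0" for c
    by (rule LIMSEQ_ignore_initial_segment[OF lim_const_over_n])
  \<comment> \<open>The factor is \<open>n / (n + 2 * s)\<close>: it changes the denominator to
    \<open>n + 2 * s\<close>, after which the joining cost is subtracted.\<close>
  have "(\<lambda>n. g n / real n * (1 - real (2 * s) / real (n + 2 * s)) - real (s\<^sup>2) / real (n + 2 * s))
      \<longlonglongrightarrow> L * (1 - 0) - 0"
    by (intro tendsto_intros L vanish)
  moreover have "\<forall>\<^sub>F n in sequentially.
      g n / real n * (1 - real (2 * s) / real (n + 2 * s)) - real (s\<^sup>2) / real (n + 2 * s) =
      real (r (n + 2 * s)) / real (n + 2 * s)"
    using eventually_gt_at_top[of 0]
  proof eventually_elim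
    case (elim n)
    have "1 - real (2 * s) / real (n + 2 * s) = real n / real (n + 2 * s)"
      using elim by (simp add: field_simps)
    then have "g n / real n * (1 - real (2 * s) / real (n + 2 * s)) = g n / real (n + 2 * s)"
      using elim by simp
    then show ?case by (simp add: g_def add_divide_distrib)
  qed
  ultimately have "(\<lambda>n. real (r (n + 2 * s)) / real (n + 2 * s)) \<longlonglongrightarrow> L"
    by (auto dest: Lim_transform_eventually)
  then have "(\<lambda>n. real (r n) / real n) \<longlonglongrightarrow> L"
    by (rule LIMSEQ_offset)
  then have "(\<lambda>n. ereal (real (r n) / real n)) \<longlonglongrightarrow> ereal L"
    by (rule tendsto_ereal)
  \<comment> \<open>Only eventual equality: at \<open>n = 0\<close> the real quotient is 0, the
    extended real one infinite.\<close>
  moreover have "\<forall>\<^sub>F n in sequentially. ereal (real (r n) / real n) =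
      ereal_of_enat (online_size_ramsey H (path_graph n)) / ereal (real n)"
    using eventually_gt_at_top[of 0] by eventually_elim (simp add: r)
  ultimately show ?thesis
    by (intro exI) (rule Lim_transform_eventually)
qed

end
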